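(* Let $n$ be a positive integer. The $n\times n\times n$ hypermatrices $\mathbf{F},\mathbf{G},\mathbf{H}$ whose entries are, for $0\le t,u,v,w<n$, $$[\mathbf{F}]_{u,t,w}=\frac{\exp\{i\frac{2\pi}{n}t(u-w)^2\}}{\sqrt[3]{n}},\quad[\mathbf{G}]_{u,v,t}=\frac{\exp\{i\frac{2\pi}{n}t(u-v)^2\}}{\sqrt[3]{n}},\quad[\mathbf{H}]_{t,v,w}=\frac{\exp\{i\frac{2\pi}{n}t(v-w)^2\}}{\sqrt[3]{n}}$$ (with $i=\sqrt{-1}$) form an uncorrelated triple $(\mathbf{F},\mathbf{G},\mathbf{H})$ if and only if the equation $$x^2+3y^2\equiv0\mod n$$ admits no integer solution other than the trivial solution $x\equiv0\mod n$ and $y\equiv0\mod n$.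
   Context: A triple $(\mathbf{F},\mathbf{G},\mathbf{H})$ of $n\times n\times n$ complex hypermatrices (indices from $0$ to $n-1$) is uncorrelated if its Bhattacharya-Mesner product $[\mathrm{Prod}(\mathbf{F},\mathbf{G},\mathbf{H})]_{u,v,w}=\sum_{0\le t<n}[\mathbf{F}]_{u,t,w}[\mathbf{G}]_{u,v,t}[\mathbf{H}]_{t,v,w}$ equals $1$ when $u=v=w$ and $0$ otherwise. *)

theory Defs
  imports Complex_Main "HOL-Number_Theory.Cong"
begin

text \<open>
  An \<open>n \<times> n \<times> n\<close> hypermatrix is a function of three natural-number indices, of which only the
  values at indices in \<open>{0..<n}\<close> are meaningful; the side length \<open>n\<close> is passed separately.
\<close>

type_synonym hypermatrix = "nat \<Rightarrow> nat \<Rightarrow> nat \<Rightarrow> complex"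

definition bm_prod :: "nat \<Rightarrow> hypermatrix \<Rightarrow> hypermatrix \<Rightarrow> hypermatrix \<Rightarrow> hypermatrix" where
  "bm_prod n F G H u v w = (\<Sum>t = 0..<n. F u t w * G u v t * H t v w)"

definition uncorrelated :: "nat \<Rightarrow> hypermatrix \<Rightarrow> hypermatrix \<Rightarrow> hypermatrix \<Rightarrow> bool" where
  "uncorrelated n F G H \<longleftrightarrow>
    (\<forall>u<n. \<forall>v<n. \<forall>w<n. bm_prod n F G H u v w = (if u = v \<and> v = w then 1 else 0))"

end

theory Submission
  imports Defs "HOL-Library.Real_Mod"
begin

text \<open>
  At indices \<open>u, v, w\<close> the \<open>t\<close>-th summand of the Bhattacharya-Mesner product is the \<open>t\<close>-th power
  of \<open>exp (2 * pi * \<i> * k / n)\<close>, divided by \<open>n\<close>, where \<open>k\<close> is the sum of the squared differences of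
  the indices. So the product is the mean value of a character of \<open>\<int> / n\<close>: it is 1 when
  \<open>n\<close> divides \<open>k\<close> and 0 otherwise. With \<open>a = u - v\<close> and \<open>b = v - w\<close> one has
  \<open>k = 2 * (a\<^sup>2 + a * b + b\<^sup>2)\<close>, and \<open>a\<close> and \<open>b\<close> run independently over all residues, so the triple
  is uncorrelated exactly when the form \<open>2 * (a\<^sup>2 + a * b + b\<^sup>2)\<close> has only the trivial zero modulo
  \<open>n\<close> (\<open>uncorrelated_iff_anisotropic\<close>).

  It remains to compare this form with \<open>x\<^sup>2 + 3 * y\<^sup>2\<close> (\<open>anisotropic_forms_iff\<close>). If \<open>n = 2 * m\<close>,
  both have a nontrivial zero, at \<open>(m, 0)\<close> and at \<open>(m, m)\<close> respectively. If \<open>n\<close> is odd, completing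
  the square gives substitutions of determinant 2 in both directions, and 2 is invertible
  modulo \<open>n\<close>.
\<close>

section \<open>Roots of unity\<close>

lemma exp_two_pi_ratio_eq_1_iff:
  fixes n :: nat and k :: int
  assumes "n > 0"
  shows "exp (\<i> * (2 * of_real pi / of_nat n) * of_int k) = (1 :: complex) \<longleftrightarrow> int n dvd k"
proof -
  have "exp (\<i> * (2 * of_real pi / of_nat n) * of_int k)
      = cis (2 * pi * real_of_int k / real n)"
    by (simp add: cis_conv_exp mult_ac)
  also have "\<dots> = 1 \<longleftrightarrow> (\<exists>j :: int. 2 * pi * real_of_int k / real n = of_int j * (2 * pi))"
    by (rule cis_eq_1_iff)
  also have "\<dots> \<longleftrightarrow> (\<exists>j :: int. real_of_int k = real_of_int (int n * j))"
    using assms by (simp add: field_simps)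
  also have "\<dots> \<longleftrightarrow> int n dvd k"
    unfolding of_int_eq_iff dvd_def ..
  finally show ?thesis .
qed

text \<open>
  Orthogonality of the characters of \<open>\<int> / n\<close>: a geometric progression whose ratio \<open>z\<close> satisfies
  \<open>z ^ n = 1\<close> sums to 0 unless \<open>z = 1\<close>.
\<close>
lemma sum_exp_two_pi_ratio:
  fixes n :: nat and k :: int
  assumes "n > 0"
  shows "(\<Sum>t = 0..<n. exp (\<i> * (2 * of_real pi / of_nat n) * of_nat t * of_int k))
    = (if int n dvd k then of_nat n else (0 :: complex))"
proof -
  define z :: complex where "z = exp (\<i> * (2 * of_real pi / of_nat n) * of_int k)"
  have power: "z ^ t = exp (\<i> * (2 * of_real pi / of_nat n) * of_nat t * of_int k)" for t
    unfolding z_def exp_of_nat_mult [symmetric] by (simp add: mult_ac)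
  have "z ^ n = exp (\<i> * (2 * of_real pi / of_nat n) * of_int (int n * k))"
    unfolding power by (simp add: mult_ac)
  also have "\<dots> = 1"
    unfolding exp_two_pi_ratio_eq_1_iff [OF assms] by simp
  finally have "z ^ n = 1" .
  have "(\<Sum>t = 0..<n. z ^ t) = (if z = 1 then of_nat n else 0)"
    using geometric_sum [of z n] \<open>z ^ n = 1\<close> by (simp add: atLeast0LessThan)
  moreover have "z = 1 \<longleftrightarrow> int n dvd k"
    unfolding z_def by (rule exp_two_pi_ratio_eq_1_iff [OF assms])
  ultimately show ?thesis
    unfolding power [symmetric] by simp
qed

section \<open>The Bhattacharya-Mesner product\<close>

text \<open>
  The three factors \<open>root 3 n\<close> in the denominators combine to the \<open>n\<close> that normalises the
  character sum.
\<close>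
lemma bm_prod_exp_squares:
  fixes n :: nat and F G H :: hypermatrix
  assumes n: "n > 0"
    and F: "\<And>u t w. u < n \<Longrightarrow> t < n \<Longrightarrow> w < n \<Longrightarrow>
      F u t w = exp (\<i> * (2 * of_real pi / of_nat n) * of_nat t * (of_nat u - of_nat w)\<^sup>2)
        / of_real (root 3 (real n))"
    and G: "\<And>u v t. u < n \<Longrightarrow> v < n \<Longrightarrow> t < n \<Longrightarrow>
      G u v t = exp (\<i> * (2 * of_real pi / of_nat n) * of_nat t * (of_nat u - of_nat v)\<^sup>2)
        / of_real (root 3 (real n))"
    and H: "\<And>t v w. t < n \<Longrightarrow> v < n \<Longrightarrow> w < n \<Longrightarrow>
      H t v w = exp (\<i> * (2 * of_real pi / of_nat n) * of_nat t * (of_nat v - of_nat w)\<^sup>2)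
        / of_real (root 3 (real n))"
    and uvw: "u < n" "v < n" "w < n"
  shows "bm_prod n F G H u v w =
    (if int n dvd (int u - int w)\<^sup>2 + (int u - int v)\<^sup>2 + (int v - int w)\<^sup>2 then 1 else 0)"
proof -
  define k where "k = (int u - int w)\<^sup>2 + (int u - int v)\<^sup>2 + (int v - int w)\<^sup>2"
  define r :: complex where "r = of_real (root 3 (real n))"
  have r3: "r * r * r = of_nat n"
  proof -
    have "r * r * r = of_real (root 3 (real n) ^ 3)"
      by (simp add: r_def power3_eq_cube)
    then show ?thesis
      by simp
  qed
  have entry: "F u t w * G u v t * H t v w
      = exp (\<i> * (2 * of_real pi / of_nat n) * of_nat t * of_int k) / of_nat n" if "t < n" for t
  proof -
    have "F u t w * G u v t * H t v w
        = exp (\<i> * (2 * of_real pi / of_nat n) * of_nat t * (of_nat u - of_nat w)\<^sup>2)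
        * exp (\<i> * (2 * of_real pi / of_nat n) * of_nat t * (of_nat u - of_nat v)\<^sup>2)
        * exp (\<i> * (2 * of_real pi / of_nat n) * of_nat t * (of_nat v - of_nat w)\<^sup>2) / (r * r * r)"
      using uvw that by (simp add: F G H r_def)
    then show ?thesis
      unfolding r3 exp_add [symmetric] distrib_left [symmetric] by (simp add: k_def)
  qed
  have "bm_prod n F G H u v w
      = (\<Sum>t = 0..<n. exp (\<i> * (2 * of_real pi / of_nat n) * of_nat t * of_int k)) / of_nat n"
    unfolding bm_prod_def sum_divide_distrib by (intro sum.cong refl entry) simp
  then show ?thesis
    unfolding sum_exp_two_pi_ratio [OF n] k_def [symmetric] using n by simp
qed

text \<open>
  The diagonal entries are always 1, so only the vanishing off the diagonal is a condition.
  It concerns only the residues of \<open>u - v\<close> and \<open>v - w\<close>, and fixing \<open>v = 0\<close> already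
  realises every pair of residues.
\<close>
lemma uncorrelated_iff_anisotropic:
  fixes n :: nat and F G H :: hypermatrix
  assumes n: "n > 0"
    and prod: "\<And>u v w. u < n \<Longrightarrow> v < n \<Longrightarrow> w < n \<Longrightarrow> bm_prod n F G H u v w =
      (if int n dvd (int u - int w)\<^sup>2 + (int u - int v)\<^sup>2 + (int v - int w)\<^sup>2 then 1 else 0)"
  shows "uncorrelated n F G H \<longleftrightarrow>
    (\<forall>a b :: int. int n dvd 2 * (a\<^sup>2 + a * b + b\<^sup>2) \<longrightarrow> int n dvd a \<and> int n dvd b)"
    (is "_ \<longleftrightarrow> ?anisotropic")
proof
  assume unc: "uncorrelated n F G H"
  show ?anisotropic
  proof (intro allI impI)
    fix a b :: int
    assume dvd: "int n dvd 2 * (a\<^sup>2 + a * b + b\<^sup>2)"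
    define u where "u = nat (a mod int n)"
    define w where "w = nat ((- b) mod int n)"
    have less: "u < n" "w < n"
      using n by (simp_all add: u_def w_def nat_less_iff)
    have u: "[int u = a] (mod int n)" and w: "[int w = - b] (mod int n)"
      using n by (simp_all add: u_def w_def cong_def)
    have "[(int u - int w)\<^sup>2 + (int u - int 0)\<^sup>2 + (int 0 - int w)\<^sup>2
        = (a - - b)\<^sup>2 + (a - int 0)\<^sup>2 + (int 0 - - b)\<^sup>2] (mod int n)"
      by (intro cong_add cong_pow cong_diff cong_refl u w)
    moreover have "(a - - b)\<^sup>2 + (a - int 0)\<^sup>2 + (int 0 - - b)\<^sup>2 = 2 * (a\<^sup>2 + a * b + b\<^sup>2)"
      by (simp add: power2_eq_square algebra_simps)
    ultimately have "int n dvd (int u - int w)\<^sup>2 + (int u - int 0)\<^sup>2 + (int 0 - int w)\<^sup>2"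
      using dvd by (simp only: cong_dvd_iff)
    with prod [OF less(1) n less(2)] have "bm_prod n F G H u 0 w = 1"
      by simp
    moreover have "bm_prod n F G H u 0 w = (if u = 0 \<and> 0 = w then 1 else 0)"
      using unc less n by (simp add: uncorrelated_def)
    ultimately have "u = 0" "w = 0"
      by (auto split: if_splits)
    with u w show "int n dvd a \<and> int n dvd b"
      by (simp add: cong_0_iff cong_sym_eq [of 0])
  qed
next
  assume aniso: ?anisotropic
  show "uncorrelated n F G H"
    unfolding uncorrelated_def
  proof (intro allI impI)
    fix u v w
    assume less: "u < n" "v < n" "w < n"
    have form: "(int u - int w)\<^sup>2 + (int u - int v)\<^sup>2 + (int v - int w)\<^sup>2
        = 2 * ((int u - int v)\<^sup>2 + (int u - int v) * (int v - int w) + (int v - int w)\<^sup>2)"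
      by (simp add: power2_eq_square algebra_simps)
    have "u = v \<and> v = w"
      if "int n dvd (int u - int w)\<^sup>2 + (int u - int v)\<^sup>2 + (int v - int w)\<^sup>2"
    proof -
      have "int n dvd int u - int v \<and> int n dvd int v - int w"
        using that aniso unfolding form by blast
      then have "[int u = int v] (mod int n)" "[int v = int w] (mod int n)"
        by (simp_all add: cong_iff_dvd_diff)
      with less show ?thesis
        by (auto simp: cong_int_iff cong_less_modulus_unique_nat)
    qed
    then show "bm_prod n F G H u v w = (if u = v \<and> v = w then 1 else 0)"
      using prod [OF less] by auto
  qed
qed

section \<open>The two quadratic forms\<close>

lemma anisotropic_forms_iff:
  fixes n :: int
  assumes "n > 0"
  shows "(\<forall>a b. n dvd 2 * (a\<^sup>2 + a * b + b\<^sup>2) \<longrightarrow> n dvd a \<and> n dvd b) \<longleftrightarrow>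
    (\<forall>x y. n dvd x\<^sup>2 + 3 * y\<^sup>2 \<longrightarrow> n dvd x \<and> n dvd y)"
    (is "?A \<longleftrightarrow> ?B")
proof (cases "even n")
  case True
  then obtain m where m: "n = 2 * m"
    by (elim evenE)
  with assms have not_dvd: "\<not> n dvd m"
    using zdvd_imp_le [of n m] by auto
  have "n dvd 2 * (m\<^sup>2 + m * 0 + 0\<^sup>2)"
    by (simp add: m power2_eq_square)
  moreover have "n dvd m\<^sup>2 + 3 * m\<^sup>2"
    by (simp add: m power2_eq_square)
  ultimately show ?thesis
    using not_dvd by blast
next
  case False
  then have "coprime n 2"
    by simp
  then have cancel: "n dvd 2 * c \<longleftrightarrow> n dvd c" for c
    by (simp add: coprime_dvd_mult_right_iff)
  show ?thesis
  proof
    assume A: ?A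
    show ?B
    proof (intro allI impI)
      fix x y
      assume "n dvd x\<^sup>2 + 3 * y\<^sup>2"
      moreover have "2 * ((x - y)\<^sup>2 + (x - y) * (2 * y) + (2 * y)\<^sup>2) = 2 * (x\<^sup>2 + 3 * y\<^sup>2)"
        by (simp add: power2_eq_square algebra_simps)
      ultimately have diff: "n dvd x - y" and "n dvd 2 * y"
        using A by (metis dvd_mult)+
      then have "n dvd y"
        by (simp add: cancel)
      with dvd_add [OF diff this] show "n dvd x \<and> n dvd y"
        by simp
    qed
  next
    assume B: ?B
    show ?A
    proof (intro allI impI)
      fix a b
      assume "n dvd 2 * (a\<^sup>2 + a * b + b\<^sup>2)"
      moreover have "(2 * a + b)\<^sup>2 + 3 * b\<^sup>2 = 2 * (2 * (a\<^sup>2 + a * b + b\<^sup>2))"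
        by (simp add: power2_eq_square algebra_simps)
      ultimately have "n dvd 2 * a + b \<and> n dvd b"
        using B by (metis dvd_mult)
      then show "n dvd a \<and> n dvd b"
        by (metis cancel dvd_add_left_iff)
    qed
  qed
qed

theorem proposition4:
  fixes n :: nat and F G H :: hypermatrix
  assumes "n > 0"
    and "\<And>u t w. u < n \<Longrightarrow> t < n \<Longrightarrow> w < n \<Longrightarrow>
      F u t w = exp (\<i> * (2 * of_real pi / of_nat n) * of_nat t * (of_nat u - of_nat w)\<^sup>2)
        / of_real (root 3 (real n))"
    and "\<And>u v t. u < n \<Longrightarrow> v < n \<Longrightarrow> t < n \<Longrightarrow>
      G u v t = exp (\<i> * (2 * of_real pi / of_nat n) * of_nat t * (of_nat u - of_nat v)\<^sup>2)
        / of_real (root 3 (real n))"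
    and "\<And>t v w. t < n \<Longrightarrow> v < n \<Longrightarrow> w < n \<Longrightarrow>
      H t v w = exp (\<i> * (2 * of_real pi / of_nat n) * of_nat t * (of_nat v - of_nat w)\<^sup>2)
        / of_real (root 3 (real n))"
  shows "uncorrelated n F G H \<longleftrightarrow>
    (\<forall>x y :: int. [x\<^sup>2 + 3 * y\<^sup>2 = 0] (mod int n) \<longrightarrow>
      [x = 0] (mod int n) \<and> [y = 0] (mod int n))"
  using uncorrelated_iff_anisotropic [OF assms(1) bm_prod_exp_squares [OF assms]]
    anisotropic_forms_iff [of "int n"] assms(1)
  by (simp add: cong_0_iff)

end
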